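(* Consider the nonlinear system $\mathbf{x}_{k+1}=\boldsymbol{f}(\mathbf{x}_k,\mathbf{u}_k)$, $\mathbf{y}_k=\boldsymbol{h}(\mathbf{x}_k)$ and the setting described in the context, and suppose Assumptions 1-5 listed there are satisfied. Let $\{\mathbf{u}_k\}_{k=0}^{N-1}$, $\{\tilde y_{i,k}\}_{k=0}^{N+d_i-1}$, $i=1,\dots,m$, be input and (noisy) output data sequences collected from the system. Let $\{\bar{\mathbf{u}}_k\}_{k=0}^{L-1}$ be a new input to be simulated, with $\bar\Xi_0=[\bar y_{1,[0,d_1-1]}^\top\ \cdots\ \bar y_{m,[0,d_m-1]}^\top]^\top$ specifying the initial condition of the transformed state $\bar\Xi$, and let $\{\bar y_{i,k}\}_{k=0}^{L+d_i-1}$ be the true resulting (noiseless) outputs. Let $\lambda>0$, and let the following optimization problem be feasible for the given $\bar\Xi_0$: $$\alpha^*\in\arg\min_{\alpha} J(\alpha):=\|\mathcal{H}\|_2^2+\lambda\max\{\varepsilon^*,w^*\}\|\alpha\|_2^2\quad\text{s.t.}\quad \bar\Xi_0=H_1(\tilde\Xi_{[0,N-L]})\alpha,$$ where $\alpha\in\mathbb{R}^{N-L+1}$ and $\mathcal{H}:=H_L(\hat\Psi(\mathbf{u},\tilde\Xi))\alpha-\hat\Psi(\bar{\mathbf{u}},H_{L+1}(\tilde\Xi)\alpha)$. Then the estimated simulated outputs are given by $\hat y_{i,[0,L+d_i-1]}=H_{L+d_i}(\tilde y_i)\alpha^*$, $i=1,\dots,m$, and the error $e_i:=\bar y_i-\hat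 y_i$ satisfies $e_{i,[0,d_i-1]}=\mathbf{0}$ and is upper bounded by $$|e_{i,k+d_i}|\le\mathcal{P}^k(K_\Xi)\Big(\varepsilon^*(1+\|\alpha^*\|_1)+\|\mathcal{G}\|_\infty\sqrt{b}+w^*(1+K_w)\|\alpha^*\|_1\Big)$$ for all $k\in\{0,\dots,L-1\}$ (and each $i\in\{1,\dots,m\}$), where $b=J(\alpha^* )-\lambda\max\{\varepsilon^*,w^*\}\|\alpha^*\|_2^2$ and $\mathcal{P}^k(K_\Xi)=(K_\Xi)^k+(K_\Xi)^{k-1}+\dots+K_\Xi+1$.
   Context: Notation. For a sequence $\{\mathbf{z}_k\}_{k=0}^{N-1}$ with $\mathbf{z}_k\in\mathbb{R}^\eta$, $\mathbf{z}=[\mathbf{z}_0^\top\ \cdots\ \mathbf{z}_{N-1}^\top]^\top$ is its stacked vector, $\mathbf{z}_{[a,b]}=[\mathbf{z}_a^\top\ \cdots\ \mathbf{z}_b^\top]^\top$ a window, and the depth-$L$ Hankel matrix $H_L(\mathbf{z})\in\mathbb{R}^{\eta L\times(N-L+1)}$ has as its $j$-th column ($j=0,\dots,N-L$) the vector $\mathbf{z}_{[j,j+L-1]}$. $\|\cdot\|_p$ is the $p$-norm of vectors and $\|M\|_\infty$ the induced $\infty$-norm of a matrix. System. $\mathbf{x}_{k+1}=\boldsymbol{f}(\mathbf{x}_k,\mathbf{u}_k)$, $\mathbf{y}_k=\boldsymbol{h}(\mathbf{x}_k)$ with $\mathbf{x}_k\in\mathbb{R}^n$, $\mathbf{u}_k,\mathbf{y}_k\in\mathbb{R}^m$,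 where $\boldsymbol{f}:\mathbb{R}^n\times\mathbb{R}^m\to\mathbb{R}^n$ and $\boldsymbol{h}=(h_1,\dots,h_m):\mathbb{R}^n\to\mathbb{R}^m$ are analytic, $\boldsymbol{f}(\mathbf{0},\mathbf{0})=\mathbf{0}$, $\boldsymbol{h}(\mathbf{0})=\mathbf{0}$. Let $\boldsymbol{f}_O^j$ be the $j$-th iterated composition of $\boldsymbol{f}_O=\boldsymbol{f}(\cdot,\mathbf{0})$. Each output $y_i$ has a globally well-defined relative degree $d_i\ge 1$: $d_i$ is the first delay at which at least one input at time $k$ affects output $i$, so that $y_{i,k},\dots,y_{i,k+d_i-1}$ are functions of $\mathbf{x}_k$ only, and $y_{i,k+d_i}=h_i(\boldsymbol{f}_O^{d_i-1}(\boldsymbol{f}(\mathbf{x}_k,\mathbf{u}_k)))$. For inputs $\{\mathbf{u}_k\}_{k=0}^{N-1}$, the outputs $y_{i,k}$ with $0\le k\le N+d_i-1$ are determined by $\mathbf{x}_0$ and these inputs. Assumption 1: for any $\mathbf{x}_k\in\mathbb{R}^n$ there is $\tilde{\mathbf{u}}_k\in\mathbb{R}^m$ with $h_i(\boldsymbol{f}_O^{d_i-1}(\boldsymbol{f}(\mathbf{x}_k,\tilde{\mathbf{u}}_k)))=0$ for all $i=1,\dots,m$. Assumption 2: for any $\mathbf{x}_k\in\mathbb{R}^n$, the decoupling matrix with $(i,j)$ entries $\partial h_i(\boldsymbol{f}_O^{d_i-1}(\boldsymbol{f}(\mathbf{x}_k,\mathbf{u}_k)))/\partial u_{j,k}$,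 evaluated at $\mathbf{u}_k=\tilde{\mathbf{u}}_k$, has rank $m$. Assumption 3: $\sum_{i=1}^m d_i=n$. Under Assumptions 1-3 it is a known result (Monaco and Normand-Cyrot) that there is an invertible coordinate transformation $\Xi_k=T(\mathbf{x}_k)$, where $\Xi_k=[y_{1,[k,k+d_1-1]}^\top\ \cdots\ y_{m,[k,k+d_m-1]}^\top]^\top\in\mathbb{R}^n$; $T^{-1}$ is continuously differentiable. Define $\Phi=(\phi_1,\dots,\phi_m)$ by $\phi_i(\mathbf{u},\Xi)=h_i(\boldsymbol{f}_O^{d_i-1}(\boldsymbol{f}(T^{-1}(\Xi),\mathbf{u})))$, so that $y_{i,k+d_i}=\phi_i(\mathbf{u}_k,\Xi_k)$ along trajectories. $\Phi$ is locally Lipschitz continuous. Basis functions. $\Psi:\mathbb{R}^m\times\mathbb{R}^n\to\mathbb{R}^r$ is a vector of $r$ locally Lipschitz continuous, linearly independent functions, and $\Phi(\mathbf{u},\Xi)=\mathcal{G}\Psi(\mathbf{u},\Xi)+\epsilon(\mathbf{u},\Xi)$, where $\mathcal{G}\in\mathbb{R}^{m\times r}$ is a minimizer over $G$ of $\langle\Phi-G\Psi,\Phi-G\Psi\rangle$ ($L^2$ inner product over a compact set $\Omega\subset\mathbb{R}^m\times\mathbb{R}^n$ of the input-state space), and $\epsilon$ is the approximation error. Assumption 4: $\mathcal{G}$ has full row rank. Assumption 5: $\|\epsilon(\mathbf{u},\Xi)\|_\infty\le\varepsilon^*$ for all $(\mathbf{u},\Xi)\in\Omega$, where $\varepsilon^*>0$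 and $\Omega$ is compact. Noise. Measured outputs are $\tilde{\mathbf{y}}_k=\mathbf{y}_k+\mathbf{w}_k$ with $\|\mathbf{w}_k\|_\infty\le w^*$ for all $k\ge 0$. Put $\omega_k=[w_{1,[k,k+d_1-1]}^\top\ \cdots\ w_{m,[k,k+d_m-1]}^\top]^\top$ and $\tilde\Xi_k=\Xi_k+\omega_k=[\tilde y_{1,[k,k+d_1-1]}^\top\ \cdots\ \tilde y_{m,[k,k+d_m-1]}^\top]^\top$, $k=0,\dots,N$, with stacked vector $\tilde\Xi$. Let $\delta(\omega_k)=\mathcal{G}\Psi(\mathbf{u}_k,\Xi_k)+\epsilon(\mathbf{u}_k,\Xi_k)-\mathcal{G}\Psi(\mathbf{u}_k,\tilde\Xi_k)-\epsilon(\mathbf{u}_k,\tilde\Xi_k)$. Standing assumption. The a priori collected input and output trajectories, as well as the simulated trajectory $(\bar{\mathbf{u}}_k,\bar\Xi_k)$, evolve in the compact set $\Omega$, where $\bar\Xi_k=[\bar y_{1,[k,k+d_1-1]}^\top\ \cdots\ \bar y_{m,[k,k+d_m-1]}^\top]^\top$. Constants. $K_\Xi$ is the Lipschitz constant of $\Phi$ with respect to $\Xi$ on the compact set $\Omega$ (in the $\infty$-norm). $K_w>0$ is a constant with $\|\delta(\omega_k)\|_\infty\le K_w w^*$ for all $k\ge 0$ (it exists by local Lipschitz continuity of $\Phi$ and $\Psi$ with respect to $\Xi$ on $\Omega$ and boundedness of $\mathbf{w}_k$). Stacked vectors. $\hat\Psi(\mathbf{u},\tilde\Xi)$ is the stacked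 vector of $\{\Psi(\mathbf{u}_k,\tilde\Xi_k)\}_{k=0}^{N-1}$. For $\alpha\in\mathbb{R}^{N-L+1}$, $\hat\Psi(\bar{\mathbf{u}},H_{L+1}(\tilde\Xi)\alpha)$ is the stacked vector of $\{\Psi(\bar{\mathbf{u}}_k,H_1(\tilde\Xi_{[k,k+N-L]})\alpha)\}_{k=0}^{L-1}$.
   Formalization: The formal theorem additionally assumes that the estimated trajectory, the pairs of new input and H_1(Ξ̃_{[k,k+N-L]})α* for k<L, lies in Ω; without this the error bound can fail, since ε* and K_Ξ are controlled only on Ω. *)

theory Defs
  imports "HOL-Analysis.Analysis"
begin

section \<open>Regularity notions\<close>

text \<open>Real analyticity in several variables: near every point the function is the sum of a
  multivariate power series. A multi-index is a function on the basis vectors, extended by zero.\<close>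

definition real_analytic_on ::
    "('a::euclidean_space \<Rightarrow> 'b::euclidean_space) \<Rightarrow> 'a set \<Rightarrow> bool" where
  "real_analytic_on F S \<longleftrightarrow>
     (\<forall>a\<in>S. \<exists>r>0. \<exists>c :: ('a \<Rightarrow> nat) \<Rightarrow> 'b. \<forall>x\<in>ball a r.
        ((\<lambda>\<mu>. (\<Prod>b\<in>Basis. ((x - a) \<bullet> b) ^ \<mu> b) *\<^sub>R c \<mu>) has_sum F x)
          {\<mu>. \<forall>b. b \<notin> Basis \<longrightarrow> \<mu> b = 0})"

definition continuously_differentiable :: "(real^'n \<Rightarrow> real^'n) \<Rightarrow> bool" where
  "continuously_differentiable F \<longleftrightarrow>
     (\<forall>x. F differentiable (at x)) \<and> continuous_on UNIV (\<lambda>x. jacobian F (at x))"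

definition locally_lipschitz :: "('a::metric_space \<Rightarrow> 'b::metric_space) \<Rightarrow> bool" where
  "locally_lipschitz F \<longleftrightarrow> (\<forall>p. \<exists>e>0. \<exists>K. K-lipschitz_on (ball p e) F)"

text \<open>Lipschitz in the second argument only, with respect to the maximum norm.\<close>

definition lipschitz_snd_infnorm ::
    "real \<Rightarrow> ('a::euclidean_space \<times> 'b::euclidean_space) set
      \<Rightarrow> ('a \<Rightarrow> 'b \<Rightarrow> 'c::euclidean_space) \<Rightarrow> bool" where
  "lipschitz_snd_infnorm K \<Omega> F \<longleftrightarrow> 0 \<le> K \<and>
     (\<forall>u \<xi> \<xi>'. (u, \<xi>) \<in> \<Omega> \<longrightarrow> (u, \<xi>') \<in> \<Omega> \<longrightarrow>
        infnorm (F u \<xi> - F u \<xi>') \<le> K * infnorm (\<xi> - \<xi>'))"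

text \<open>The matrix norm induced by the maximum norm; the vector 0 contributes the value 0.\<close>

definition matrix_infnorm :: "real^'r^'m \<Rightarrow> real" where
  "matrix_infnorm A = (SUP v. infnorm (A *v v) / infnorm v)"

section \<open>The system, relative degree and decoupling matrix\<close>

text \<open>Input sequences are total functions on the naturals. The output \<open>i\<close> at times
  \<open>k < N + d i\<close>, with \<open>d i\<close> its relative degree, depends only on the inputs at times
  \<open>k < N\<close>, so how a finite input sequence is extended is immaterial.\<close>

primrec state :: "('x \<Rightarrow> 'u \<Rightarrow> 'x) \<Rightarrow> 'x \<Rightarrow> (nat \<Rightarrow> 'u) \<Rightarrow> nat \<Rightarrow> 'x" where
  "state f x0 u 0 = x0"
| "state f x0 u (Suc k) = f (state f x0 u k) (u k)"

definition outputs ::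
    "('x \<Rightarrow> 'u \<Rightarrow> 'x) \<Rightarrow> ('x \<Rightarrow> 'y) \<Rightarrow> 'x \<Rightarrow> (nat \<Rightarrow> 'u) \<Rightarrow> nat \<Rightarrow> 'y" where
  "outputs f h x0 u k = h (state f x0 u k)"

definition undriven :: "('x \<Rightarrow> 'u::zero \<Rightarrow> 'x) \<Rightarrow> 'x \<Rightarrow> 'x" where
  "undriven f x = f x 0"

text \<open>The output \<open>j \<ge> 1\<close> steps after the input \<open>u\<close> is applied in state \<open>x\<close>, all later inputs
  being zero.\<close>

definition delayed_output ::
    "('x \<Rightarrow> 'u::zero \<Rightarrow> 'x) \<Rightarrow> ('x \<Rightarrow> 'y) \<Rightarrow> nat \<Rightarrow> 'x \<Rightarrow> 'u \<Rightarrow> 'y" where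
  "delayed_output f h j x u = h ((undriven f ^^ (j - 1)) (f x u))"

definition has_relative_degree ::
    "(real^'n \<Rightarrow> real^'m \<Rightarrow> real^'n) \<Rightarrow> (real^'n \<Rightarrow> real^'m) \<Rightarrow> 'm \<Rightarrow> nat \<Rightarrow> bool" where
  "has_relative_degree f h i d \<longleftrightarrow> 1 \<le> d \<and>
     (\<forall>j. 1 \<le> j \<and> j < d \<longrightarrow>
        (\<forall>x u u'. delayed_output f h j x u $ i = delayed_output f h j x u' $ i)) \<and>
     (\<forall>x. \<exists>u u'. delayed_output f h d x u $ i \<noteq> delayed_output f h d x u' $ i)"

definition decoupled_output ::
    "(real^'n \<Rightarrow> real^'m \<Rightarrow> real^'n) \<Rightarrow> (real^'n \<Rightarrow> real^'m) \<Rightarrow> ('m \<Rightarrow> nat)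
      \<Rightarrow> real^'n \<Rightarrow> real^'m \<Rightarrow> real^'m" where
  "decoupled_output f h d x u = (\<chi> i. delayed_output f h (d i) x u $ i)"

definition decoupling_matrix ::
    "(real^'n \<Rightarrow> real^'m \<Rightarrow> real^'n) \<Rightarrow> (real^'n \<Rightarrow> real^'m) \<Rightarrow> ('m \<Rightarrow> nat)
      \<Rightarrow> real^'n \<Rightarrow> real^'m \<Rightarrow> real^'m^'m" where
  "decoupling_matrix f h d x u =
     (\<chi> i j. deriv (\<lambda>s. decoupled_output f h d x (u + s *\<^sub>R axis j 1) $ i) 0)"

section \<open>The transformed state\<close>

text \<open>The entries of the transformed state are labelled by pairs \<open>(i, j)\<close> with \<open>j < d i\<close>. The map
  \<open>pos\<close> is an enumeration of these labels by the coordinates of \<open>real^'n\<close>; it fixes the order in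
  which the output windows are stacked.\<close>

definition stacking_order :: "('m::finite \<Rightarrow> nat) \<Rightarrow> ('n::finite \<Rightarrow> 'm \<times> nat) \<Rightarrow> bool" where
  "stacking_order d pos \<longleftrightarrow> bij_betw pos UNIV (SIGMA i:UNIV. {..<d i})"

definition output_window :: "('n \<Rightarrow> 'm \<times> nat) \<Rightarrow> (nat \<Rightarrow> real^'m) \<Rightarrow> nat \<Rightarrow> real^'n" where
  "output_window pos y k = (\<chi> l. y (k + snd (pos l)) $ fst (pos l))"

text \<open>The transformation \<open>T\<close>: below the relative degree the outputs do not depend on the inputs,
  so they can be computed with zero inputs.\<close>

definition coord_transform ::
    "(real^'n \<Rightarrow> real^'m \<Rightarrow> real^'n) \<Rightarrow> (real^'n \<Rightarrow> real^'m) \<Rightarrow> ('n \<Rightarrow> 'm \<times> nat)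
      \<Rightarrow> real^'n \<Rightarrow> real^'n" where
  "coord_transform f h pos x = (\<chi> l. h ((undriven f ^^ snd (pos l)) x) $ fst (pos l))"

definition io_map ::
    "(real^'n \<Rightarrow> real^'m \<Rightarrow> real^'n) \<Rightarrow> (real^'n \<Rightarrow> real^'m) \<Rightarrow> ('m \<Rightarrow> nat) \<Rightarrow> ('n \<Rightarrow> 'm \<times> nat)
      \<Rightarrow> real^'m \<Rightarrow> real^'n \<Rightarrow> real^'m" where
  "io_map f h d pos u \<xi> = decoupled_output f h d (inv (coord_transform f h pos) \<xi>) u"

section \<open>Basis function approximation\<close>

definition lin_indep_components :: "('u \<Rightarrow> 'x \<Rightarrow> real^'r) \<Rightarrow> bool" where
  "lin_indep_components \<Psi> \<longleftrightarrow> (\<forall>c. (\<forall>u \<xi>. (\<Sum>s\<in>UNIV. c $ s * \<Psi> u \<xi> $ s) = 0) \<longrightarrow> c = 0)"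

definition approx_error ::
    "('u \<Rightarrow> 'x \<Rightarrow> real^'m) \<Rightarrow> ('u \<Rightarrow> 'x \<Rightarrow> real^'r) \<Rightarrow> real^'r^'m \<Rightarrow> 'u \<Rightarrow> 'x \<Rightarrow> real^'m" where
  "approx_error \<Phi> \<Psi> G u \<xi> = \<Phi> u \<xi> - G *v \<Psi> u \<xi>"

definition L2_error ::
    "('u::euclidean_space \<times> 'x::euclidean_space) set \<Rightarrow> ('u \<Rightarrow> 'x \<Rightarrow> real^'m)
      \<Rightarrow> ('u \<Rightarrow> 'x \<Rightarrow> real^'r) \<Rightarrow> real^'r^'m \<Rightarrow> real" where
  "L2_error \<Omega> \<Phi> \<Psi> G =
     (LINT p:\<Omega>|lborel. approx_error \<Phi> \<Psi> G (fst p) (snd p) \<bullet> approx_error \<Phi> \<Psi> G (fst p) (snd p))"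

text \<open>The effect of evaluating \<open>G \<Psi> + \<epsilon>\<close> at the measured instead of the true transformed state.\<close>

definition noise_effect ::
    "('u \<Rightarrow> 'x \<Rightarrow> real^'m) \<Rightarrow> ('u \<Rightarrow> 'x \<Rightarrow> real^'r) \<Rightarrow> real^'r^'m
      \<Rightarrow> 'u \<Rightarrow> 'x \<Rightarrow> 'x \<Rightarrow> real^'m" where
  "noise_effect \<Phi> \<Psi> G u \<xi> \<xi>' =
     G *v \<Psi> u \<xi> + approx_error \<Phi> \<Psi> G u \<xi> - G *v \<Psi> u \<xi>' - approx_error \<Phi> \<Psi> G u \<xi>'"

section \<open>Hankel matrices and the data-driven optimization problem\<close>

text \<open>Stacked vectors are kept in block form. A coefficient vector in \<open>\<real>\<^sup>q\<close> is a function on the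
  naturals of which only the entries below \<open>q\<close> are used.\<close>

definition window :: "(nat \<Rightarrow> 'v) \<Rightarrow> nat \<Rightarrow> nat \<Rightarrow> 'v" where
  "window z a l = z (a + l)"

text \<open>Block \<open>l\<close> of column \<open>j\<close>; this does not depend on the depth.\<close>

definition hankel :: "(nat \<Rightarrow> 'v) \<Rightarrow> nat \<Rightarrow> nat \<Rightarrow> 'v" where
  "hankel z l j = window z j l"

text \<open>Block \<open>l\<close>, for \<open>l < L\<close>, of the product of the depth-\<open>L\<close> Hankel matrix of \<open>z 0, ..., z (N - 1)\<close>,
  which has \<open>N - L + 1\<close> columns, with the vector \<open>\<alpha>\<close>.\<close>

definition hankel_mult ::
    "nat \<Rightarrow> nat \<Rightarrow> (nat \<Rightarrow> 'v::real_vector) \<Rightarrow> (nat \<Rightarrow> real) \<Rightarrow> nat \<Rightarrow> 'v" where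
  "hankel_mult N L z \<alpha> l = (\<Sum>j < N + 1 - L. \<alpha> j *\<^sub>R hankel z l j)"

text \<open>\<open>predicted_state N L \<xi> \<alpha> k\<close> is the product of the depth-1 Hankel matrix of
  \<open>\<xi> k, ..., \<xi> (k + N - L)\<close> with \<open>\<alpha>\<close>, that is, block \<open>k\<close> of the product of the depth-\<open>(L + 1)\<close> Hankel
  matrix of \<open>\<xi> 0, ..., \<xi> N\<close> with \<open>\<alpha>\<close>.\<close>

definition predicted_state ::
    "nat \<Rightarrow> nat \<Rightarrow> (nat \<Rightarrow> 'v::real_vector) \<Rightarrow> (nat \<Rightarrow> real) \<Rightarrow> nat \<Rightarrow> 'v" where
  "predicted_state N L \<xi> \<alpha> k = hankel_mult (N - L + 1) 1 (window \<xi> k) \<alpha> 0"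

definition basis_mismatch ::
    "nat \<Rightarrow> nat \<Rightarrow> ('u \<Rightarrow> 'x::real_vector \<Rightarrow> real^'r) \<Rightarrow> (nat \<Rightarrow> 'u) \<Rightarrow> (nat \<Rightarrow> 'x)
      \<Rightarrow> (nat \<Rightarrow> 'u) \<Rightarrow> (nat \<Rightarrow> real) \<Rightarrow> nat \<Rightarrow> real^'r" where
  "basis_mismatch N L \<Psi> u \<xi> ub \<alpha> k =
     hankel_mult N L (\<lambda>t. \<Psi> (u t) (\<xi> t)) \<alpha> k - \<Psi> (ub k) (predicted_state N L \<xi> \<alpha> k)"

text \<open>The squared Euclidean norm of the stacked mismatch plus the regularization \<open>\<rho> \<parallel>\<alpha>\<parallel>\<^sup>2\<close>.\<close>

definition sim_cost ::
    "nat \<Rightarrow> nat \<Rightarrow> ('u \<Rightarrow> 'x::real_vector \<Rightarrow> real^'r) \<Rightarrow> (nat \<Rightarrow> 'u) \<Rightarrow> (nat \<Rightarrow> 'x)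
      \<Rightarrow> (nat \<Rightarrow> 'u) \<Rightarrow> real \<Rightarrow> (nat \<Rightarrow> real) \<Rightarrow> real" where
  "sim_cost N L \<Psi> u \<xi> ub \<rho> \<alpha> =
     (L2_set (\<lambda>k. norm (basis_mismatch N L \<Psi> u \<xi> ub \<alpha> k)) {..<L})\<^sup>2
     + \<rho> * (L2_set \<alpha> {..<N - L + 1})\<^sup>2"

end

theory Submission
  imports Defs
begin

text \<open>By definition of the relative degree, an input cannot reach output \<open>i\<close> in fewer than \<open>d i\<close>
  steps. Hence the window of outputs that makes up the transformed state at time \<open>k\<close> is a function
  \<open>T\<close> of the state at time \<open>k\<close> alone, and since \<open>T\<close> is injective, the first output values that the
  input \<open>u k\<close> can influence are \<open>\<Phi> (u k) (\<Xi> k)\<close>. This one-step law holds along the collected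
  and along the simulated trajectory (\<open>io_map_along_trajectory\<close>).

  The estimate combines the collected outputs linearly with the weights \<open>\<alpha> j\<close>. Writing each collected
  output as \<open>G \<Psi>\<close> at the measured state, plus the approximation error, the effect of the noise on
  the state and the noise on the output, the \<open>\<Psi>\<close>-part of the combination equals \<open>G \<Psi>\<close> at
  the estimated state up to \<open>G\<close> times the basis mismatch, whose size is controlled by the value
  \<open>b\<close> of the data-fitting term. So at each step the estimate deviates from \<open>\<Phi>\<close> evaluated at the
  estimated state by at most a constant \<open>c\<close> independent of the step, while the Lipschitz constant
  bounds what the error of the estimated state contributes
  (\<open>one_step_prediction_error\<close>).

  The error of the estimated state is itself made of output errors of earlier prediction steps,
  the very first ones being zero by the constraint on \<open>\<alpha>\<close>. Iterating \<open>M \<mapsto> K M + c\<close> gives the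
  geometric sum (\<open>delayed_error_recursion\<close>).\<close>

section \<open>Outputs and the relative degree\<close>

text \<open>Inputs with fewer than \<open>d\<close> steps to go are invisible in output \<open>i\<close>, so one may replace them
  by zero one at a time. The extra \<open>r\<close> undriven steps make the induction on \<open>p\<close> go through.\<close>

lemma output_component_undriven:
  assumes "has_relative_degree f h i d" and "r + p < d"
  shows "h ((undriven f ^^ r) (state f x0 u (k + p))) $ i
       = h ((undriven f ^^ (r + p)) (state f x0 u k)) $ i"
  using assms(2)
proof (induction p arbitrary: r)
  case 0
  then show ?case by simp
next
  case (Suc p)
  let ?x = "state f x0 u (k + p)"
  have "delayed_output f h (Suc r) ?x (u (k + p)) $ i = delayed_output f h (Suc r) ?x 0 $ i"
    using assms(1) Suc.prems by (simp add: has_relative_degree_def)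
  then have "h ((undriven f ^^ r) (state f x0 u (k + Suc p))) $ i
      = h ((undriven f ^^ Suc r) ?x) $ i"
    by (simp add: delayed_output_def undriven_def funpow_swap1)
  also have "\<dots> = h ((undriven f ^^ (Suc r + p)) (state f x0 u k)) $ i"
    using Suc.IH[of "Suc r"] Suc.prems by simp
  finally show ?case by simp
qed

lemma output_at_relative_degree:
  assumes "has_relative_degree f h i d"
  shows "outputs f h x0 u (k + d) $ i = delayed_output f h d (state f x0 u k) (u k) $ i"
proof -
  have "1 \<le> d" using assms by (simp add: has_relative_degree_def)
  then show ?thesis
    using output_component_undriven[OF assms, where r = 0 and p = "d - 1" and k = "Suc k"]
    by (simp add: outputs_def delayed_output_def)
qed

lemma stacking_order_delay_less:
  assumes "stacking_order d pos"
  shows "snd (pos l) < d (fst (pos l))"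
  using bij_betwE[OF assms[unfolded stacking_order_def]] by (metis UNIV_I mem_Sigma_iff
      prod.collapse lessThan_iff)

lemma stacking_order_obtains:
  assumes "stacking_order d pos" and "s < d i"
  obtains l where "pos l = (i, s)"
  using assms unfolding stacking_order_def bij_betw_def by (metis (no_types, lifting)
      UNIV_I image_iff lessThan_iff mem_Sigma_iff)

lemma output_window_eq_coord_transform:
  assumes "\<And>i. has_relative_degree f h i (d i)" and "stacking_order d pos"
  shows "output_window pos (outputs f h x0 u) k = coord_transform f h pos (state f x0 u k)"
  using output_component_undriven[OF assms(1), where r = 0] stacking_order_delay_less[OF assms(2)]
  by (simp add: vec_eq_iff output_window_def coord_transform_def outputs_def)

text \<open>The output window at time \<open>k\<close> determines the state at time \<open>k\<close>, hence together with the
  current input also the outputs that leave the window next.\<close>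

lemma io_map_along_trajectory:
  assumes "\<And>i. has_relative_degree f h i (d i)" and "stacking_order d pos"
    and "inj (coord_transform f h pos)"
  shows "io_map f h d pos (u k) (output_window pos (outputs f h x0 u) k)
       = (\<chi> i. outputs f h x0 u (k + d i) $ i)"
  by (simp add: io_map_def output_window_eq_coord_transform[OF assms(1,2)] inv_f_f[OF assms(3)]
      decoupled_output_def output_at_relative_degree[OF assms(1)])

section \<open>The maximum norm\<close>

lemma infnorm_le_cart_iff:
  fixes x :: "real^'n"
  shows "infnorm x \<le> c \<longleftrightarrow> (\<forall>l. \<bar>x $ l\<bar> \<le> c)"
proof
  assume "infnorm x \<le> c"
  then show "\<forall>l. \<bar>x $ l\<bar> \<le> c" using component_le_infnorm_cart order_trans by blast
next
  assume *: "\<forall>l. \<bar>x $ l\<bar> \<le> c"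
  show "infnorm x \<le> c" unfolding infnorm_cart
    by (rule cSup_least) (use * in auto)
qed

lemma infnorm_diff_le: "infnorm (x - y) \<le> infnorm x + infnorm y"
  using infnorm_triangle[of x "- y"] by (simp add: infnorm_neg)

lemma infnorm_weighted_sum_le:
  assumes "finite A" and "\<And>j. j \<in> A \<Longrightarrow> infnorm (x j) \<le> c"
  shows "infnorm (\<Sum>j\<in>A. \<alpha> j *\<^sub>R x j) \<le> (\<Sum>j\<in>A. \<bar>\<alpha> j\<bar>) * c"
  using assms
proof (induction A rule: finite_induct)
  case empty
  then show ?case by (simp add: infnorm_0)
next
  case (insert a A)
  have "infnorm (\<alpha> a *\<^sub>R x a) \<le> \<bar>\<alpha> a\<bar> * c"
    using insert.prems by (simp add: infnorm_mul mult_left_mono)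
  moreover have "infnorm (\<Sum>j\<in>A. \<alpha> j *\<^sub>R x j) \<le> (\<Sum>j\<in>A. \<bar>\<alpha> j\<bar>) * c"
    using insert by simp
  ultimately show ?case
    using infnorm_triangle[of "\<alpha> a *\<^sub>R x a" "\<Sum>j\<in>A. \<alpha> j *\<^sub>R x j"] insert.hyps
    by (simp add: distrib_right)
qed

text \<open>A supremum of reals is an upper bound only if the set is bounded. Here this follows from the
  equivalence of the maximum norm and the Euclidean norm.\<close>

lemma bdd_above_matrix_infnorm:
  fixes A :: "real^'r^'m"
  shows "bdd_above (range (\<lambda>v. infnorm (A *v v) / infnorm v))"
proof -
  obtain B where B: "B > 0" "\<And>v. norm (A *v v) \<le> B * norm v"
    using linear_bounded_pos[OF matrix_vector_mul_linear[of A]] by auto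
  let ?s = "sqrt DIM(real^'r)"
  have "infnorm (A *v v) / infnorm v \<le> B * ?s" for v
  proof (cases "v = 0")
    case True
    then show ?thesis using B(1) by (simp add: infnorm_0)
  next
    case False
    have "infnorm (A *v v) \<le> B * norm v"
      using infnorm_le_norm B(2) order_trans by blast
    also have "\<dots> \<le> B * (?s * infnorm v)"
      using norm_le_infnorm[of v] B(1) by (simp add: mult_left_mono)
    finally show ?thesis
      using False by (simp add: divide_le_eq infnorm_pos_lt mult.assoc)
  qed
  then show ?thesis by (intro bdd_aboveI2)
qed

lemma matrix_infnorm_nonneg: "0 \<le> matrix_infnorm A"
  using cSUP_upper[OF UNIV_I bdd_above_matrix_infnorm[of A], of 0]
  by (simp add: matrix_infnorm_def infnorm_0)

lemma infnorm_matrix_vector_le: "infnorm (A *v v) \<le> matrix_infnorm A * infnorm v"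
proof (cases "v = 0")
  case True
  then show ?thesis by (simp add: infnorm_0)
next
  case False
  have "infnorm (A *v v) / infnorm v \<le> matrix_infnorm A"
    unfolding matrix_infnorm_def by (rule cSUP_upper[OF UNIV_I bdd_above_matrix_infnorm])
  then show ?thesis
    using False by (simp add: divide_le_eq infnorm_pos_lt)
qed

section \<open>Products with Hankel matrices\<close>

lemma predicted_state_eq:
  "predicted_state N L \<xi> \<alpha> k = (\<Sum>j < N - L + 1. \<alpha> j *\<^sub>R \<xi> (k + j))"
  by (simp add: predicted_state_def hankel_mult_def hankel_def window_def)

lemma hankel_mult_eq:
  assumes "L \<le> N"
  shows "hankel_mult N L z \<alpha> k = (\<Sum>j < N - L + 1. \<alpha> j *\<^sub>R z (k + j))"
proof -
  have "N + 1 - L = N - L + 1" using assms by simp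
  then show ?thesis by (simp add: hankel_mult_def hankel_def window_def add.commute)
qed

text \<open>Both estimates apply the same weights to the same measured outputs; so the estimated state is
  a window of estimated outputs.\<close>

lemma predicted_state_component:
  assumes "L \<le> N" and "pos l = (i, s)"
  shows "predicted_state N L (output_window pos y) \<alpha> k $ l
       = hankel_mult (N + d) (L + d) (\<lambda>t. y t $ i) \<alpha> (k + s)"
  using assms by (simp add: predicted_state_eq hankel_mult_eq output_window_def ac_simps)

lemma basis_mismatch_eq:
  assumes "L \<le> N"
  shows "basis_mismatch N L \<Psi> u \<xi> ub \<alpha> k
    = (\<Sum>j < N - L + 1. \<alpha> j *\<^sub>R \<Psi> (u (k + j)) (\<xi> (k + j))) - \<Psi> (ub k) (predicted_state N L \<xi> \<alpha> k)"
  using assms by (simp add: basis_mismatch_def hankel_mult_eq)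

text \<open>Without its regularization term, the cost is the square of the Euclidean norm of the stacked
  mismatch, which dominates the maximum norm of each block.\<close>

lemma infnorm_basis_mismatch_le:
  assumes "k < L"
  shows "infnorm (basis_mismatch N L \<Psi> u \<xi> ub \<alpha> k)
    \<le> sqrt (sim_cost N L \<Psi> u \<xi> ub \<rho> \<alpha> - \<rho> * (L2_set \<alpha> {..<N - L + 1})\<^sup>2)"
proof -
  let ?m = "basis_mismatch N L \<Psi> u \<xi> ub \<alpha>"
  have "infnorm (?m k) \<le> norm (?m k)" by (rule infnorm_le_norm)
  also have "\<dots> \<le> L2_set (\<lambda>k. norm (?m k)) {..<L}"
    using assms member_le_L2_set[of "{..<L}" k "\<lambda>k. norm (?m k)"] by simp
  also have "\<dots> = sqrt (sim_cost N L \<Psi> u \<xi> ub \<rho> \<alpha> - \<rho> * (L2_set \<alpha> {..<N - L + 1})\<^sup>2)"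
    by (simp add: sim_cost_def)
  finally show ?thesis .
qed

section \<open>Propagation of the prediction error\<close>

text \<open>This compares the true output \<open>\<Phi> ub \<xi>b\<close> with a weighted sum of noisy outputs
  \<open>\<Phi> (u j) (\<xi> j) + v j\<close>. Both are referred to \<open>\<Phi>\<close> at the estimated state \<open>\<xi>h\<close>: the first by
  the Lipschitz condition, the second by expanding \<open>\<Phi> = G \<Psi> + \<epsilon>\<close> at the measured states \<open>\<xi>t j\<close>.
  The linear map \<open>G\<close> commutes with the weighted sum, which leaves only \<open>G\<close> applied to
  the failure of the weighted sum to commute with \<open>\<Psi>\<close>.\<close>

lemma one_step_prediction_error:
  fixes \<Phi> :: "'u::euclidean_space \<Rightarrow> 'x::euclidean_space \<Rightarrow> real^'m"
    and \<Psi> :: "'u \<Rightarrow> 'x \<Rightarrow> real^'r" and G :: "real^'r^'m" and n :: nat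
  assumes lipschitz: "lipschitz_snd_infnorm K \<Omega> \<Phi>"
    and in_\<Omega>: "(ub, \<xi>b) \<in> \<Omega>" "(ub, \<xi>h) \<in> \<Omega>" "\<And>j. j < n \<Longrightarrow> (u j, \<xi>t j) \<in> \<Omega>"
    and approx: "\<And>v \<xi>. (v, \<xi>) \<in> \<Omega> \<Longrightarrow> infnorm (approx_error \<Phi> \<Psi> G v \<xi>) \<le> eps"
    and state_noise: "\<And>j. j < n \<Longrightarrow> infnorm (noise_effect \<Phi> \<Psi> G (u j) (\<xi> j) (\<xi>t j)) \<le> Kw * wmax"
    and output_noise: "\<And>j. j < n \<Longrightarrow> infnorm (v j) \<le> wmax"
  shows "infnorm (\<Phi> ub \<xi>b - (\<Sum>j<n. \<alpha> j *\<^sub>R (\<Phi> (u j) (\<xi> j) + v j)))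
    \<le> K * infnorm (\<xi>b - \<xi>h)
      + (eps * (1 + (\<Sum>j<n. \<bar>\<alpha> j\<bar>))
         + matrix_infnorm G * infnorm ((\<Sum>j<n. \<alpha> j *\<^sub>R \<Psi> (u j) (\<xi>t j)) - \<Psi> ub \<xi>h)
         + wmax * (1 + Kw) * (\<Sum>j<n. \<bar>\<alpha> j\<bar>))"
proof -
  let ?\<epsilon> = "approx_error \<Phi> \<Psi> G"
  let ?\<delta> = "\<lambda>j. noise_effect \<Phi> \<Psi> G (u j) (\<xi> j) (\<xi>t j)"
  let ?S = "\<Sum>j<n. \<bar>\<alpha> j\<bar>"
  define D where "D = \<Phi> ub \<xi>b - \<Phi> ub \<xi>h"
  define m where "m = (\<Sum>j<n. \<alpha> j *\<^sub>R \<Psi> (u j) (\<xi>t j)) - \<Psi> ub \<xi>h"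
  define R where "R = (\<Sum>j<n. \<alpha> j *\<^sub>R (?\<epsilon> (u j) (\<xi>t j) + ?\<delta> j + v j))"
  have "(\<Sum>j<n. \<alpha> j *\<^sub>R (\<Phi> (u j) (\<xi> j) + v j))
      = (\<Sum>j<n. \<alpha> j *\<^sub>R (G *v \<Psi> (u j) (\<xi>t j))) + R"
    unfolding R_def sum.distrib[symmetric] scaleR_add_right[symmetric]
    by (simp add: noise_effect_def approx_error_def)
  also have "(\<Sum>j<n. \<alpha> j *\<^sub>R (G *v \<Psi> (u j) (\<xi>t j))) = G *v m + G *v \<Psi> ub \<xi>h"
    by (simp add: m_def matrix_vector_mult_diff_distrib linear_sum[OF matrix_vector_mul_linear]
        matrix_vector_mult_scaleR)
  finally have split: "\<Phi> ub \<xi>b - (\<Sum>j<n. \<alpha> j *\<^sub>R (\<Phi> (u j) (\<xi> j) + v j))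
      = ((D + ?\<epsilon> ub \<xi>h) - G *v m) - R"
    by (simp add: D_def approx_error_def)
  have D: "infnorm D \<le> K * infnorm (\<xi>b - \<xi>h)"
    using lipschitz in_\<Omega>(1,2) by (simp add: lipschitz_snd_infnorm_def D_def)
  have R: "infnorm R \<le> ?S * (eps + Kw * wmax + wmax)"
    unfolding R_def
  proof (rule infnorm_weighted_sum_le)
    fix j assume "j \<in> {..<n}"
    then have "infnorm (?\<epsilon> (u j) (\<xi>t j)) \<le> eps" "infnorm (?\<delta> j) \<le> Kw * wmax"
        "infnorm (v j) \<le> wmax"
      using approx in_\<Omega>(3) state_noise output_noise by auto
    then show "infnorm (?\<epsilon> (u j) (\<xi>t j) + ?\<delta> j + v j) \<le> eps + Kw * wmax + wmax"
      using infnorm_triangle[of "?\<epsilon> (u j) (\<xi>t j) + ?\<delta> j" "v j"]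
        infnorm_triangle[of "?\<epsilon> (u j) (\<xi>t j)" "?\<delta> j"] by linarith
  qed simp
  have "infnorm (((D + ?\<epsilon> ub \<xi>h) - G *v m) - R)
      \<le> K * infnorm (\<xi>b - \<xi>h) + eps + matrix_infnorm G * infnorm m
        + ?S * (eps + Kw * wmax + wmax)"
    using infnorm_diff_le[of "(D + ?\<epsilon> ub \<xi>h) - G *v m" R] infnorm_diff_le[of "D + ?\<epsilon> ub \<xi>h" "G *v m"]
      infnorm_triangle[of D "?\<epsilon> ub \<xi>h"] D R approx[OF in_\<Omega>(2)] infnorm_matrix_vector_le[of G m]
    by linarith
  then show ?thesis
    unfolding split m_def by (simp add: algebra_simps)
qed

lemma sum_powers_atMost: "(\<Sum>j\<le>k. K ^ j) = 1 + K * (\<Sum>j<k. K ^ j)"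
  for K :: "'a::comm_semiring_1"
  unfolding lessThan_Suc_atMost[symmetric] sum.lessThan_Suc_shift by (simp add: sum_distrib_left)

text \<open>A discrete Gronwall argument. Channel \<open>i\<close> at time \<open>k + d i\<close> depends on the errors in all the
  windows \<open>k, ..., k + d i' - 1\<close>. An entry of such a window is either one of the vanishing initial
  values or was produced in a step before \<open>k\<close>, so strong induction on \<open>k\<close> over all channels at once
  yields the same growth as for a recursion of order one.\<close>

lemma delayed_error_recursion:
  fixes e :: "'i \<Rightarrow> nat \<Rightarrow> real"
  assumes nonneg: "0 \<le> K" "0 \<le> c"
    and initial: "\<And>i s. s < d i \<Longrightarrow> e i s = 0"
    and step: "\<And>i k M. k < L \<Longrightarrow> (\<And>i' s. s < d i' \<Longrightarrow> \<bar>e i' (k + s)\<bar> \<le> M) \<Longrightarrow>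
      \<bar>e i (k + d i)\<bar> \<le> K * M + c"
    and "k < L"
  shows "\<bar>e i (k + d i)\<bar> \<le> (\<Sum>j\<le>k. K ^ j) * c"
  using \<open>k < L\<close>
proof (induction k arbitrary: i rule: less_induct)
  case (less k)
  let ?M = "(\<Sum>j<k. K ^ j) * c"
  have "\<bar>e i' (k + s)\<bar> \<le> ?M" if "s < d i'" for i' s
  proof (cases "k + s < d i'")
    case True
    then show ?thesis using initial nonneg by (simp add: sum_nonneg)
  next
    case False
    define p where "p = k + s - d i'"
    have p: "p < k" "k + s = p + d i'" using False that by (auto simp: p_def)
    have "\<bar>e i' (k + s)\<bar> \<le> (\<Sum>j\<le>p. K ^ j) * c"
      using less.IH[OF p(1)] p less.prems by simp
    also have "\<dots> \<le> ?M"
      using p(1) nonneg by (intro mult_right_mono sum_mono2) auto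
    finally show ?thesis .
  qed
  then have "\<bar>e i (k + d i)\<bar> \<le> K * ?M + c"
    using step[OF less.prems] by blast
  also have "\<dots> = (\<Sum>j\<le>k. K ^ j) * c"
    by (simp add: sum_powers_atMost distrib_right)
  finally show ?case .
qed

section \<open>The error bound for the data-driven simulation\<close>

theorem theorem3:
  fixes f :: "real^'n \<Rightarrow> real^'m \<Rightarrow> real^'n"
    and h :: "real^'n \<Rightarrow> real^'m"
    and d :: "'m \<Rightarrow> nat"
    and pos :: "'n \<Rightarrow> 'm \<times> nat"
    and ut :: "real^'n \<Rightarrow> real^'m"
    and T :: "real^'n \<Rightarrow> real^'n"
    and \<Phi> :: "real^'m \<Rightarrow> real^'n \<Rightarrow> real^'m"
    and \<Psi> :: "real^'m \<Rightarrow> real^'n \<Rightarrow> real^'r"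
    and G :: "real^'r^'m"
    and \<Omega> :: "((real^'m) \<times> (real^'n)) set"
    and u ub w y yt yb :: "nat \<Rightarrow> real^'m"
    and x0 xb0 :: "real^'n"
    and \<Xi> \<Xi>t \<Xi>b :: "nat \<Rightarrow> real^'n"
    and eps wmax K\<Xi> Kw lam b :: real
    and N L :: nat
    and J :: "(nat \<Rightarrow> real) \<Rightarrow> real"
    and \<alpha> :: "nat \<Rightarrow> real"
    and yh e :: "'m \<Rightarrow> nat \<Rightarrow> real"
  assumes f_analytic: "real_analytic_on (\<lambda>(x, v). f x v) UNIV"
    and h_analytic: "real_analytic_on h UNIV"
    and f_zero: "f 0 0 = 0"
    and h_zero: "h 0 = 0"
    and rel_degree: "\<And>i. has_relative_degree f h i (d i)"
    and assumption1: "\<And>x i. delayed_output f h (d i) x (ut x) $ i = 0"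
    and assumption2: "\<And>x. rank (decoupling_matrix f h d x (ut x)) = CARD('m)"
    and assumption3: "(\<Sum>i\<in>UNIV. d i) = CARD('n)"
    and order: "stacking_order d pos"
    and T_def: "T = coord_transform f h pos"
    and T_invertible: "bij T"
    and T_inv_C1: "continuously_differentiable (inv T)"
    and \<Phi>_def: "\<Phi> = io_map f h d pos"
    and \<Phi>_lipschitz: "locally_lipschitz (\<lambda>(v, \<xi>). \<Phi> v \<xi>)"
    and \<Psi>_lipschitz: "locally_lipschitz (\<lambda>(v, \<xi>). \<Psi> v \<xi>)"
    and \<Psi>_independent: "lin_indep_components \<Psi>"
    and \<Omega>_compact: "compact \<Omega>"
    and G_minimizer: "is_arg_min (L2_error \<Omega> \<Phi> \<Psi>) (\<lambda>_. True) G"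
    and assumption4: "rank G = CARD('m)"
    and eps_pos: "eps > 0"
    and assumption5: "\<And>v \<xi>. (v, \<xi>) \<in> \<Omega> \<Longrightarrow> infnorm (approx_error \<Phi> \<Psi> G v \<xi>) \<le> eps"
    and horizon: "1 \<le> L" "L \<le> N"
    \<comment> \<open>collected data: the true outputs \<open>y\<close>, the measured outputs \<open>yt\<close>\<close>
    and y_def: "y = outputs f h x0 u"
    and noise_bound: "\<And>k. infnorm (w k) \<le> wmax"
    and yt_def: "\<And>k. yt k = y k + w k"
    and \<Xi>_def: "\<Xi> = output_window pos y"
    and \<Xi>t_def: "\<Xi>t = output_window pos yt"
    \<comment> \<open>simulated trajectory\<close>
    and yb_def: "yb = outputs f h xb0 ub"
    and \<Xi>b_def: "\<Xi>b = output_window pos yb"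
    \<comment> \<open>optimization problem and simulated outputs\<close>
    and lam_pos: "lam > 0"
    and J_def: "J = sim_cost N L \<Psi> u \<Xi>t ub (lam * max eps wmax)"
    and \<alpha>_optimal: "is_arg_min J (\<lambda>a. \<Xi>b 0 = predicted_state N L \<Xi>t a 0) \<alpha>"
    and b_def: "b = J \<alpha> - lam * max eps wmax * (L2_set \<alpha> {..<N - L + 1})\<^sup>2"
    and yh_def: "\<And>i. yh i = hankel_mult (N + d i) (L + d i) (\<lambda>k. yt k $ i) \<alpha>"
    and e_def: "\<And>i k. e i k = yb k $ i - yh i k"
    \<comment> \<open>the data, the simulated trajectory and its estimate stay in \<open>\<Omega>\<close>\<close>
    and data_in_\<Omega>: "\<And>k. k < N \<Longrightarrow> (u k, \<Xi>t k) \<in> \<Omega>"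
    and sim_in_\<Omega>: "\<And>k. k < L \<Longrightarrow> (ub k, \<Xi>b k) \<in> \<Omega>"
    and est_in_\<Omega>: "\<And>k. k < L \<Longrightarrow> (ub k, predicted_state N L \<Xi>t \<alpha> k) \<in> \<Omega>"
    \<comment> \<open>constants\<close>
    and K\<Xi>_lipschitz: "lipschitz_snd_infnorm K\<Xi> \<Omega> \<Phi>"
    and Kw_pos: "Kw > 0"
    and Kw_bound: "\<And>k. k < N \<Longrightarrow> infnorm (noise_effect \<Phi> \<Psi> G (u k) (\<Xi> k) (\<Xi>t k)) \<le> Kw * wmax"
  shows "(\<forall>i. \<forall>k < d i. e i k = 0) \<and>
         (\<forall>i. \<forall>k < L. \<bar>e i (k + d i)\<bar> \<le>
            (\<Sum>j\<le>k. K\<Xi> ^ j) *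
              (eps * (1 + (\<Sum>j < N - L + 1. \<bar>\<alpha> j\<bar>)) + matrix_infnorm G * sqrt b
               + wmax * (1 + Kw) * (\<Sum>j < N - L + 1. \<bar>\<alpha> j\<bar>)))"
proof -
  define S where "S = (\<Sum>j < N - L + 1. \<bar>\<alpha> j\<bar>)"
  define c where "c = eps * (1 + S) + matrix_infnorm G * sqrt b + wmax * (1 + Kw) * S"
  define \<Xi>h where "\<Xi>h = predicted_state N L \<Xi>t \<alpha>"
  have inj: "inj (coord_transform f h pos)"
    using T_invertible T_def by (simp add: bij_is_inj)
  have data_law: "\<Phi> (u t) (\<Xi> t) = (\<chi> i. y (t + d i) $ i)" for t
    unfolding \<Phi>_def \<Xi>_def y_def by (rule io_map_along_trajectory[OF rel_degree order inj])
  have sim_law: "\<Phi> (ub t) (\<Xi>b t) = (\<chi> i. yb (t + d i) $ i)" for t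
    unfolding \<Phi>_def \<Xi>b_def yb_def by (rule io_map_along_trajectory[OF rel_degree order inj])
  have mismatch: "infnorm (basis_mismatch N L \<Psi> u \<Xi>t ub \<alpha> k) \<le> sqrt b" if "k < L" for k
    using infnorm_basis_mismatch_le[OF that] unfolding b_def J_def .
  have state_error: "(\<Xi>b k - \<Xi>h k) $ l = e i (k + s)" if "pos l = (i, s)" for k l i s
    using predicted_state_component[where pos = pos and l = l, OF horizon(2) that, where d = "d i"] that
    by (simp add: \<Xi>h_def \<Xi>t_def \<Xi>b_def e_def yh_def output_window_def)
  have initial: "e i s = 0" if "s < d i" for i s
  proof -
    obtain l where "pos l = (i, s)" using stacking_order_obtains[OF order \<open>s < d i\<close>] .
    moreover have "\<Xi>b 0 = \<Xi>h 0"
      using \<alpha>_optimal by (simp add: is_arg_min_def \<Xi>h_def)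
    ultimately show ?thesis using state_error[of l i s 0] by simp
  qed
  have step: "\<bar>e i (k + d i)\<bar> \<le> K\<Xi> * M + c"
    if "k < L" and M: "\<And>i' s. s < d i' \<Longrightarrow> \<bar>e i' (k + s)\<bar> \<le> M" for i k M
  proof -
    let ?n = "N - L + 1"
    let ?v = "\<lambda>t. \<chi> i. w (t + d i) $ i"
    \<comment> \<open>the last column starts at \<open>N - L\<close>, so block \<open>k < L\<close> stays within the \<open>N\<close> data points\<close>
    have in_range: "k + j < N" if "j < ?n" for j
      using that \<open>k < L\<close> horizon by linarith
    have noise: "infnorm (?v t) \<le> wmax" for t
      using noise_bound unfolding infnorm_le_cart_iff by simp
    have "infnorm (\<Xi>b k - \<Xi>h k) \<le> M"
      unfolding infnorm_le_cart_iff
    proof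
      fix l
      have "snd (pos l) < d (fst (pos l))" by (rule stacking_order_delay_less[OF order])
      then show "\<bar>(\<Xi>b k - \<Xi>h k) $ l\<bar> \<le> M"
        using M state_error[of l "fst (pos l)" "snd (pos l)" k] by simp
    qed
    then have KM: "K\<Xi> * infnorm (\<Xi>b k - \<Xi>h k) \<le> K\<Xi> * M"
      using K\<Xi>_lipschitz by (intro mult_left_mono) (auto simp: lipschitz_snd_infnorm_def)
    have Gm: "matrix_infnorm G * infnorm (basis_mismatch N L \<Psi> u \<Xi>t ub \<alpha> k)
        \<le> matrix_infnorm G * sqrt b"
      by (rule mult_left_mono[OF mismatch[OF \<open>k < L\<close>] matrix_infnorm_nonneg])
    \<comment> \<open>Component \<open>i\<close> of this vector lives at time \<open>k + d i\<close>: the one-step laws align the outputs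
      of all channels, in spite of their different delays, with the common time \<open>k\<close>.\<close>
    let ?E = "\<Phi> (ub k) (\<Xi>b k) - (\<Sum>j<?n. \<alpha> j *\<^sub>R (\<Phi> (u (k + j)) (\<Xi> (k + j)) + ?v (k + j)))"
    have "infnorm ?E \<le> K\<Xi> * infnorm (\<Xi>b k - \<Xi>h k)
      + (eps * (1 + S) + matrix_infnorm G * infnorm (basis_mismatch N L \<Psi> u \<Xi>t ub \<alpha> k)
         + wmax * (1 + Kw) * S)"
      unfolding S_def basis_mismatch_eq[OF horizon(2)] \<Xi>h_def
      by (rule one_step_prediction_error[where \<Omega> = \<Omega> and \<xi>t = "\<lambda>j. \<Xi>t (k + j)"])
        (use K\<Xi>_lipschitz sim_in_\<Omega> est_in_\<Omega> data_in_\<Omega> assumption5 Kw_bound noise in_range \<open>k < L\<close>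
          in auto)
    also have "\<dots> \<le> K\<Xi> * M + c" using KM Gm by (simp add: c_def)
    finally have "\<bar>?E $ i\<bar> \<le> K\<Xi> * M + c" by (simp only: infnorm_le_cart_iff)
    also have "?E $ i = e i (k + d i)"
      by (simp add: data_law sim_law e_def yh_def hankel_mult_eq horizon yt_def ac_simps)
    finally show ?thesis .
  qed
  have "0 \<le> K\<Xi>" using K\<Xi>_lipschitz by (simp add: lipschitz_snd_infnorm_def)
  moreover have "0 \<le> c"
  proof -
    have "0 \<le> wmax" using infnorm_pos_le noise_bound by (rule order_trans)
    moreover have "0 \<le> sqrt b"
      using infnorm_pos_le mismatch horizon(1) by (metis One_nat_def Suc_le_lessD order_trans)
    moreover have "0 \<le> S" by (simp add: S_def sum_nonneg)
    ultimately show ?thesis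
      using eps_pos Kw_pos matrix_infnorm_nonneg[of G] by (simp add: c_def)
  qed
  ultimately have "\<bar>e i (k + d i)\<bar> \<le> (\<Sum>j\<le>k. K\<Xi> ^ j) * c" if "k < L" for i k
    using delayed_error_recursion[of K\<Xi> c d e L, OF _ _ initial step] that by blast
  with initial show ?thesis by (simp add: c_def S_def)
qed

end
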